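(* In online matching with online items and non-myopic offline agents with private graph edges, the Explore-Exploit Mechanism (defined in the context) is truthful, and computes an $O(\log n)$ approximation to the optimal social welfare, where $n$ is the number of buyers (asymptotics as $n\to\infty$, with an absolute implied constant).
   Context: Model. There is a bipartite graph $G=(B,I;E)$ with a set $B$ of $n$ buyers, known in advance, and a set $I$ of $m$ items arriving one by one in an unknown, possibly adversarial order (item $j$ arrives at time $j$). Buyer $i$ is interested in the items $j$ with $(i,j)\in E$, and has a value $v_i\ge 0$ for obtaining at least one item she is interested in (value $0$ otherwise). Private graph edges: both $v_i$ and the set of items $i$ is interested in are private information of $i$. When item $j$ arrives, every buyer declares whether she is interested in $j$ and, if so, a value; she may misreport both. All nonzero bids of buyer $i$ must equal a single value. A mechanism, possibly randomized, decides upon the arrival of $j$, immediately and irrevocably and using only the bids on items up to $j$, either to assign $j$ to a buyer who declared interest in it and has not been assigned an item yet, or to leave $j$ unassigned forever. The result is a (random) matching $\mu$ ($\mu^{-1}_i$ is the item received by $i$, $\emptyset$ if none). The mechanism also charges non-negative payments $p_i$. Welfare. $\mathrm{SW}(\mu)=\sum_{i\in B} v_i\cdot \mathbb{I}[(i,\mu^{-1}_i)\in E]$, and the optimal social welfare is $\mathrm{OPT}=\mathrm{SW}(\mu^\star)$ where $\mu^\star$ is a maximum weight matching in $G$. A mechanism gives an $\alpha$ approximation if $\mathrm{OPT}\le\alpha\cdot \mathbb{E}[\mathrm{SW}(\mu)]$ on every instance (with truthful reports). Truthfulness. Non-myopic buyers know the whole sequence of items and maximize the quasi-linear utility $u_i=v_i\cdot\mathbb{I}[(i,\mu_i^{-1})\in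 E]-p_i$. A mechanism is truthful (in the ex-post sense) if, for every realization of the mechanism's random choices, every instance and every behavior of the other buyers, each agent maximizes her utility by reporting her value and her interests truthfully. Mechanisms are required to be ex-post individually rational: truthful agents have non-negative utility in every realization. Explore-Exploit Mechanism. Initialization: set $p\leftarrow 0$; draw $k$ uniformly from $\{0,1,\dots,\lceil\log_2 n\rceil\}$; independently for each buyer $i$ draw a type $t_i$ uniformly from $\{\text{Explore},\text{Exploit}\}$. When an item arrives: buyers report whether they are interested in it. For each buyer $i$ of type Explore who is interested in the item, set $p\leftarrow\max(p, v_i/2^k)$, where $v_i$ is her reported value. Then sell the item at price $p$ to a buyer of type Exploit who is interested in buying the item at price $p$ (i.e. is interested in the item and has reported value at least $p$) and does not yet have an item, chosen arbitrarily (e.g. lowest index); if there is no such buyer the item is left unassigned. Buyers of type Explore never receive an item.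
   Formalization: The choice of buyer is not fully arbitrary: truthfulness needs it independent of irrelevant candidates; the O(log n) bound needs distinct values or that buyers valued above the price go first. Otherwise it fails: lowest index, one item, n-1 values 1 and a last, huge one. *)

theory Defs
  imports
    "HOL-Probability.Probability"
    "HOL-Library.Sublist"
    "HOL-Library.Landau_Symbols"
begin

(* Buyers are 0, ..., n - 1; items are 0, ..., m - 1 in order of arrival, so that quantifying over
   all edge sets also quantifies over all arrival orders. *)

definition market :: "nat \<Rightarrow> nat \<Rightarrow> (nat \<times> nat) set \<Rightarrow> (nat \<Rightarrow> real) \<Rightarrow> bool" where
  "market n m E v \<longleftrightarrow> E \<subseteq> {..<n} \<times> {..<m} \<and> (\<forall>i<n. 0 \<le> v i)"

definition matching :: "nat \<Rightarrow> (nat \<times> nat) set \<Rightarrow> (nat \<Rightarrow> nat option) \<Rightarrow> bool" where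
  "matching n E \<mu> \<longleftrightarrow>
     dom \<mu> \<subseteq> {..<n} \<and> (\<forall>i j. \<mu> i = Some j \<longrightarrow> (i, j) \<in> E) \<and> inj_on \<mu> (dom \<mu>)"

definition obtained :: "(nat \<times> nat) set \<Rightarrow> (nat \<Rightarrow> real) \<Rightarrow> (nat \<Rightarrow> nat option) \<Rightarrow> nat \<Rightarrow> real" where
  "obtained E v \<mu> i = (if \<exists>j. \<mu> i = Some j \<and> (i, j) \<in> E then v i else 0)"

definition social_welfare ::
    "nat \<Rightarrow> (nat \<times> nat) set \<Rightarrow> (nat \<Rightarrow> real) \<Rightarrow> (nat \<Rightarrow> nat option) \<Rightarrow> real" where
  "social_welfare n E v \<mu> = (\<Sum>i<n. obtained E v \<mu> i)"

definition opt :: "nat \<Rightarrow> (nat \<times> nat) set \<Rightarrow> (nat \<Rightarrow> real) \<Rightarrow> real" where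
  "opt n E v = Max (social_welfare n E v ` {\<mu>. matching n E \<mu>})"

(* Entry j of a history is the price posted for item j together with the buyer who received it
   (and paid that price), if any. The item about to be decided is number "length h". *)
type_synonym history = "(real \<times> nat option) list"

definition assigned :: "history \<Rightarrow> nat \<Rightarrow> nat option" where
  "assigned h i =
     (if \<exists>j<length h. snd (h ! j) = Some i
      then Some (LEAST j. j < length h \<and> snd (h ! j) = Some i) else None)"

definition payment :: "history \<Rightarrow> nat \<Rightarrow> real" where
  "payment h i = (\<Sum>j<length h. if snd (h ! j) = Some i then fst (h ! j) else 0)"

definition utility :: "(nat \<times> nat) set \<Rightarrow> (nat \<Rightarrow> real) \<Rightarrow> history \<Rightarrow> nat \<Rightarrow> real" where
  "utility E v h i = obtained E v (assigned h) i - payment h i"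

(* A buyer's behaviour may react to everything announced so far (prices and assignments), but not
   to the sealed bids of the others. On item "length h" she bids None (no interest declared)
   or Some w (interest declared, with value w). *)
type_synonym behavior = "history \<Rightarrow> real option"

definition admissible :: "behavior \<Rightarrow> bool" where
  "admissible d \<longleftrightarrow>
     (\<forall>h w. d h = Some w \<longrightarrow> 0 \<le> w) \<and>
     (\<forall>h h' w w'. prefix h h' \<and> d h = Some w \<and> d h' = Some w' \<and> w \<noteq> 0 \<and> w' \<noteq> 0 \<longrightarrow> w = w')"

definition truthful_report :: "(nat \<times> nat) set \<Rightarrow> (nat \<Rightarrow> real) \<Rightarrow> nat \<Rightarrow> behavior" where
  "truthful_report E v i h = (if (i, length h) \<in> E then Some (v i) else None)"

(* A mechanism maps its random seed, the behaviours and a number m to the history after m items;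
   R is the distribution of the seed. *)
type_synonym 'r mechanism = "'r \<Rightarrow> (nat \<Rightarrow> behavior) \<Rightarrow> nat \<Rightarrow> history"

definition truthful :: "nat \<Rightarrow> 'r pmf \<Rightarrow> 'r mechanism \<Rightarrow> bool" where
  "truthful n R M \<longleftrightarrow>
     (\<forall>r \<in> set_pmf R. \<forall>m E v b i d.
        market n m E v \<and> i < n \<and> (\<forall>l<n. admissible (b l)) \<and> admissible d \<longrightarrow>
        utility E v (M r (b(i := d)) m) i
          \<le> utility E v (M r (b(i := truthful_report E v i)) m) i)"

definition individually_rational :: "nat \<Rightarrow> 'r pmf \<Rightarrow> 'r mechanism \<Rightarrow> bool" where
  "individually_rational n R M \<longleftrightarrow>
     (\<forall>r \<in> set_pmf R. \<forall>m E v b i.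
        market n m E v \<and> i < n \<and> (\<forall>l<n. admissible (b l)) \<longrightarrow>
        0 \<le> utility E v (M r (b(i := truthful_report E v i)) m) i)"

definition expected_welfare ::
    "nat \<Rightarrow> 'r pmf \<Rightarrow> 'r mechanism \<Rightarrow> nat \<Rightarrow> (nat \<times> nat) set \<Rightarrow> (nat \<Rightarrow> real) \<Rightarrow> real" where
  "expected_welfare n R M m E v =
     measure_pmf.expectation R
       (\<lambda>r. social_welfare n E v (assigned (M r (truthful_report E v) m)))"

datatype buyer_type = Explore | Exploit

definition ee_seed :: "nat \<Rightarrow> (nat \<times> (nat \<Rightarrow> buyer_type)) pmf" where
  "ee_seed n =
     pair_pmf (pmf_of_set {0..nat \<lceil>log 2 (real n)\<rceil>})
              (Pi_pmf {..<n} Exploit (\<lambda>_. pmf_of_set {Explore, Exploit}))"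

(* The "arbitrary" choice of a buyer: "sel h C S" is the buyer chosen from the set C of candidates,
   those willing to buy at the current price p; S is the set of candidates whose reported
   value exceeds p. The other candidates report exactly p. *)
type_synonym selection = "history \<Rightarrow> nat set \<Rightarrow> nat set \<Rightarrow> nat"

definition selection_rule :: "selection \<Rightarrow> bool" where
  "selection_rule sel \<longleftrightarrow>
     (\<forall>h C S. finite C \<and> C \<noteq> {} \<and> S \<subseteq> C \<longrightarrow> sel h C S \<in> C)"

(* Needed for truthfulness: if reporting interest without winning could change which other buyer
   wins, a buyer could thereby remove a competitor for a later item. Every priority order on the
   buyers (possibly depending on the history) gives a consistent rule, see below. *)
definition consistent :: "selection \<Rightarrow> bool" where
  "consistent sel \<longleftrightarrow>
     (\<forall>h C C' S. finite C \<and> S \<subseteq> C \<and> C' \<subseteq> C \<and> sel h C S \<in> C' \<longrightarrow>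
        sel h C' (S \<inter> C') = sel h C S) \<and>
     (\<forall>h C S i. finite C \<and> S \<subseteq> C \<and> i \<in> C \<and> sel h C S = i \<longrightarrow> sel h C (insert i S) = i)"

(* Candidates who would gain nothing at the current price are served only if nobody else is
   willing to buy. Without this, ties between values are fatal for the approximation: if one
   item interests n - 1 buyers of value 1 and, last in the order of choice, one of value V, then
   the large buyer obtains it only if all others are Explore, so that the ratio tends to 2 ^ n
   as V grows. *)
definition gainers_first :: "selection \<Rightarrow> bool" where
  "gainers_first sel \<longleftrightarrow>
     (\<forall>h C S. finite C \<and> S \<subseteq> C \<and> S \<noteq> {} \<longrightarrow> sel h C S \<in> S)"

definition current_price :: "history \<Rightarrow> real" where
  "current_price h = (if h = [] then 0 else fst (last h))"

fun explore_exploit ::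
    "nat \<Rightarrow> selection \<Rightarrow> (nat \<times> (nat \<Rightarrow> buyer_type)) mechanism" where
  "explore_exploit n sel (k, t) b 0 = []"
| "explore_exploit n sel (k, t) b (Suc j) =
     (let h = explore_exploit n sel (k, t) b j;
          p = Max (insert (current_price h)
                {w / 2 ^ k | i w. i < n \<and> t i = Explore \<and> b i h = Some w});
          C = {i. i < n \<and> t i = Exploit \<and> assigned h i = None \<and> (\<exists>w. b i h = Some w \<and> p \<le> w)};
          S = {i \<in> C. \<exists>w. b i h = Some w \<and> p < w}
      in h @ [(p, if C = {} then None else Some (sel h C S))])"

lemma arg_min_on_restrict:
  fixes r :: "nat \<Rightarrow> nat"
  assumes "inj r" "finite C" "C' \<subseteq> C" "arg_min_on r C \<in> C'"
  shows "arg_min_on r C' = arg_min_on r C"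
proof -
  have fin: "finite C'" and ne: "C' \<noteq> {}" "C \<noteq> {}"
    using assms finite_subset by auto
  have "r (arg_min_on r C) \<le> r (arg_min_on r C')"
    using arg_min_least[OF assms(2) ne(2)] arg_min_if_finite(1)[OF fin ne(1)] assms(3) by blast
  moreover have "r (arg_min_on r C') \<le> r (arg_min_on r C)"
    using arg_min_least[OF fin ne(1)] assms(4) by blast
  ultimately show ?thesis
    using assms(1) by (simp add: inj_eq)
qed

lemma priority_order_rule:
  fixes rank :: "history \<Rightarrow> nat \<Rightarrow> nat"
  assumes "\<And>h. inj (rank h)"
  defines "sel \<equiv> \<lambda>h C S. arg_min_on (rank h) C"
  shows "selection_rule sel" "consistent sel"
  using assms(1) arg_min_if_finite(1)
  by (auto simp: selection_rule_def consistent_def sel_def intro: arg_min_on_restrict)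

lemma gainers_first_priority_order_rule:
  fixes rank :: "history \<Rightarrow> nat \<Rightarrow> nat"
  assumes inj: "\<And>h. inj (rank h)"
  defines "sel \<equiv> \<lambda>h C S. arg_min_on (rank h) (if S = {} then C else S)"
  shows "selection_rule sel" "consistent sel" "gainers_first sel"
proof -
  have mem: "arg_min_on (rank h) C \<in> C" if "finite C" "C \<noteq> {}" for h and C :: "nat set"
    using arg_min_if_finite(1)[OF that] .
  show g: "gainers_first sel"
    unfolding gainers_first_def sel_def using mem finite_subset by auto
  show "selection_rule sel"
    unfolding selection_rule_def
  proof (intro allI impI)
    fix h :: history and C S :: "nat set" assume a: "finite C \<and> C \<noteq> {} \<and> S \<subseteq> C"
    then have "finite S" using finite_subset by blast
    with a mem[of C h] mem[of S h] show "sel h C S \<in> C"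
      by (auto simp: sel_def)
  qed
  show "consistent sel"
    unfolding consistent_def
  proof (intro conjI allI impI)
    fix h :: history and C C' S :: "nat set" assume a: "finite C \<and> S \<subseteq> C \<and> C' \<subseteq> C \<and> sel h C S \<in> C'"
    show "sel h C' (S \<inter> C') = sel h C S"
    proof (cases "S = {}")
      case True
      then show ?thesis using a arg_min_on_restrict[OF inj, of C C' h] by (simp add: sel_def)
    next
      case False
      have fin: "finite S" using a finite_subset by blast
      from mem[OF fin False, of h] a False have "arg_min_on (rank h) S \<in> S \<inter> C'"
        by (simp add: sel_def)
      with arg_min_on_restrict[OF inj fin, of "S \<inter> C'" h] False show ?thesis
        by (auto simp: sel_def)
    qed
  next
    fix h :: history and C S :: "nat set" and i assume a: "finite C \<and> S \<subseteq> C \<and> i \<in> C \<and> sel h C S = i"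
    show "sel h C (insert i S) = i"
    proof (cases "S = {}")
      case True
      then show ?thesis using mem[of "{i}" h] by (simp add: sel_def)
    next
      case False
      have "finite S" using a finite_subset by blast
      with mem[of S h] a False have "i \<in> S" by (auto simp: sel_def)
      then show ?thesis using a by (simp add: insert_absorb)
    qed
  qed
qed

end

theory Submission
  imports Defs
begin

text \<open>
  Truthfulness: prices depend on Explore buyers only and never decrease. A deviation of an Exploit
  buyer leaves the history unchanged until she is served in one of the two runs, because by
  consistency her losing bids do not affect who wins. At that moment the truthful run gives her the
  first item she can gain from, and it is never cheaper later.

  Approximation: let \<open>V\<close> be the top value of a buyer with an edge and \<open>K = \<lceil>log 2 n\<rceil>\<close>.
  With \<open>k = 0\<close>, the top buyer Exploit and her best rival for one of her items Explore, the welfare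
  is at least \<open>V\<close>; hence the expected welfare is at least \<open>V / (4 (K + 1))\<close>. Split the buyers
  served by an optimal matching into three groups. Buyers of value at most \<open>V / n\<close> contribute at
  most \<open>V\<close>. A buyer \<open>i\<close> with optimal item \<open>j\<close> is leading if no other buyer of value at least
  \<open>v i / 2\<close> is interested in an item up to \<open>j\<close>; ordered by optimal item, leading values at least
  double, so they contribute at most \<open>2 V\<close>. For every remaining buyer \<open>i\<close>, with probability at
  least 1/4 she is Exploit and the explored maximum at time \<open>j\<close> is at least \<open>v i / 2\<close>, and then
  some \<open>k \<le> K\<close> puts the price at \<open>j\<close> between \<open>v i / 2\<close> and \<open>v i\<close>. At that price either \<open>j\<close>
  is sold or \<open>i\<close> already has an item, so some buyer obtains at least the price, and each buyer is
  charged at most twice in this way.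
\<close>

subsection \<open>Runs of the mechanism\<close>

text \<open>The price, candidates, gainers and winner of one round as functions of the history, so
  that two runs can be compared round by round.\<close>

definition ee_price ::
    "nat \<Rightarrow> nat \<Rightarrow> (nat \<Rightarrow> buyer_type) \<Rightarrow> (nat \<Rightarrow> behavior) \<Rightarrow> history \<Rightarrow> real" where
  "ee_price n k t b h =
     Max (insert (current_price h) {w / 2 ^ k | i w. i < n \<and> t i = Explore \<and> b i h = Some w})"

definition ee_cands ::
    "nat \<Rightarrow> nat \<Rightarrow> (nat \<Rightarrow> buyer_type) \<Rightarrow> (nat \<Rightarrow> behavior) \<Rightarrow> history \<Rightarrow> nat set" where
  "ee_cands n k t b h =
     {i. i < n \<and> t i = Exploit \<and> assigned h i = None \<and>
         (\<exists>w. b i h = Some w \<and> ee_price n k t b h \<le> w)}"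

definition ee_gainers ::
    "nat \<Rightarrow> nat \<Rightarrow> (nat \<Rightarrow> buyer_type) \<Rightarrow> (nat \<Rightarrow> behavior) \<Rightarrow> history \<Rightarrow> nat set" where
  "ee_gainers n k t b h =
     {i \<in> ee_cands n k t b h. \<exists>w. b i h = Some w \<and> ee_price n k t b h < w}"

definition ee_winner ::
    "nat \<Rightarrow> selection \<Rightarrow> nat \<Rightarrow> (nat \<Rightarrow> buyer_type) \<Rightarrow> (nat \<Rightarrow> behavior) \<Rightarrow> history \<Rightarrow> nat option"
  where
  "ee_winner n sel k t b h =
     (if ee_cands n k t b h = {} then None
      else Some (sel h (ee_cands n k t b h) (ee_gainers n k t b h)))"

text \<open>Takes the place of the recursive simp rule, which would expose the maximum and the set
  comprehensions in every goal.\<close>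

lemma explore_exploit_Suc:
  "explore_exploit n sel (k, t) b (Suc j) =
     (let h = explore_exploit n sel (k, t) b j
      in h @ [(ee_price n k t b h, ee_winner n sel k t b h)])"
  by (simp add: Let_def ee_price_def ee_winner_def ee_cands_def ee_gainers_def)

declare explore_exploit.simps(2) [simp del]

lemma length_explore_exploit [simp]: "length (explore_exploit n sel (k, t) b j) = j"
  by (induction j) (simp_all add: explore_exploit_Suc Let_def)

text \<open>Histories grow only at the end. Hence every claim about entries of a long history
  becomes a claim about the round in which they were written.\<close>

lemma explore_exploit_nth:
  assumes "j < m"
  shows "explore_exploit n sel (k, t) b m ! j =
    (ee_price n k t b (explore_exploit n sel (k, t) b j),
     ee_winner n sel k t b (explore_exploit n sel (k, t) b j))"
  using assms
  by (induction m) (auto simp: explore_exploit_Suc Let_def nth_append less_Suc_eq)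

lemma finite_ee_cands: "finite (ee_cands n k t b h)"
  by (rule finite_subset[of _ "{..<n}"]) (auto simp: ee_cands_def)

lemma ee_gainers_subset: "ee_gainers n k t b h \<subseteq> ee_cands n k t b h"
  by (auto simp: ee_gainers_def)

lemma ee_winner_in_cands:
  assumes "selection_rule sel" "ee_winner n sel k t b h = Some i"
  shows "i \<in> ee_cands n k t b h"
  using assms finite_ee_cands ee_gainers_subset
  unfolding ee_winner_def selection_rule_def by (metis option.distinct(1) option.inject)

lemma finite_explored_bids:
  fixes n :: nat and b :: "nat \<Rightarrow> behavior"
  shows "finite {w / 2 ^ k :: real | i w. i < n \<and> t i = Explore \<and> b i h = Some w}"
  by (rule finite_subset[of _ "(\<lambda>i. the (b i h) / 2 ^ k) ` {..<n}"]) force+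

lemma ee_price_ge_current: "current_price h \<le> ee_price n k t b h"
  unfolding ee_price_def using finite_explored_bids by (intro Max_ge) auto

lemma current_price_Suc:
  "current_price (explore_exploit n sel (k, t) b (Suc j)) =
     ee_price n k t b (explore_exploit n sel (k, t) b j)"
  by (simp add: explore_exploit_Suc Let_def current_price_def)

lemma ee_price_mono:
  assumes "i \<le> j"
  shows "ee_price n k t b (explore_exploit n sel (k, t) b i)
    \<le> ee_price n k t b (explore_exploit n sel (k, t) b j)"
  using assms
proof (induction j rule: dec_induct)
  case (step j)
  then show ?case
    using ee_price_ge_current current_price_Suc order_trans by metis
qed simp

lemma ee_price_nonneg: "0 \<le> ee_price n k t b (explore_exploit n sel (k, t) b j)"
proof -
  have "0 \<le> ee_price n k t b (explore_exploit n sel (k, t) b 0)"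
    using ee_price_ge_current[of "[]"] by (simp add: current_price_def)
  then show ?thesis
    using ee_price_mono[of 0 j] order_trans by blast
qed

section \<open>Reading off who is served, and when\<close>

lemma assigned_eq_None_iff: "assigned h i = None \<longleftrightarrow> (\<forall>j<length h. snd (h ! j) \<noteq> Some i)"
  by (auto simp: assigned_def)

lemma assigned_SomeD:
  assumes "assigned h i = Some j"
  shows "j < length h" "snd (h ! j) = Some i"
proof -
  have ex: "\<exists>j. j < length h \<and> snd (h ! j) = Some i"
    and j: "j = (LEAST j. j < length h \<and> snd (h ! j) = Some i)"
    using assms by (auto simp: assigned_def split: if_splits)
  from LeastI_ex[OF ex] show "j < length h" "snd (h ! j) = Some i"
    by (auto simp: j)
qed

text \<open>A win is recorded in all later histories, where \<open>assigned\<close> bars the winner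
  from the candidates.\<close>

lemma explore_exploit_winner_unique:
  assumes "selection_rule sel"
    and "ee_winner n sel k t b (explore_exploit n sel (k, t) b j) = Some i"
    and "ee_winner n sel k t b (explore_exploit n sel (k, t) b j') = Some i"
  shows "j = j'"
proof -
  have "\<not> j < j'" if "ee_winner n sel k t b (explore_exploit n sel (k, t) b j) = Some i"
    and "ee_winner n sel k t b (explore_exploit n sel (k, t) b j') = Some i" for j j'
    using that(1) ee_winner_in_cands[OF assms(1) that(2)]
    by (auto simp: ee_cands_def assigned_eq_None_iff explore_exploit_nth)
  then show ?thesis
    using assms(2,3) by (meson nat_neq_iff)
qed

text \<open>Since a buyer wins at most once, the \<open>LEAST\<close> in \<open>assigned\<close> has
  only one index to choose from.\<close>

lemma assigned_explore_exploit_iff: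
  assumes "selection_rule sel"
  shows "assigned (explore_exploit n sel (k, t) b m) i = Some j \<longleftrightarrow>
    j < m \<and> ee_winner n sel k t b (explore_exploit n sel (k, t) b j) = Some i"
proof
  assume "assigned (explore_exploit n sel (k, t) b m) i = Some j"
  from assigned_SomeD[OF this]
  show "j < m \<and> ee_winner n sel k t b (explore_exploit n sel (k, t) b j) = Some i"
    by (simp add: explore_exploit_nth)
next
  assume j: "j < m \<and> ee_winner n sel k t b (explore_exploit n sel (k, t) b j) = Some i"
  then have "assigned (explore_exploit n sel (k, t) b m) i \<noteq> None"
    by (auto simp: assigned_eq_None_iff explore_exploit_nth)
  then obtain j' where j': "assigned (explore_exploit n sel (k, t) b m) i = Some j'"
    by blast
  from assigned_SomeD[OF this] have "j' = j"
    using j explore_exploit_winner_unique[OF assms] by (simp add: explore_exploit_nth)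
  with j' show "assigned (explore_exploit n sel (k, t) b m) i = Some j"
    by simp
qed

lemma assigned_explore_exploit_None_iff:
  "assigned (explore_exploit n sel (k, t) b m) i = None \<longleftrightarrow>
    (\<forall>j<m. ee_winner n sel k t b (explore_exploit n sel (k, t) b j) \<noteq> Some i)"
  by (auto simp: assigned_eq_None_iff explore_exploit_nth)

subsection \<open>Truthfulness\<close>

lemma utility_unassigned:
  assumes "assigned h i = None"
  shows "utility E v h i = 0"
proof -
  have "payment h i = 0"
    using assms by (simp add: payment_def assigned_eq_None_iff)
  with assms show ?thesis
    by (simp add: utility_def obtained_def)
qed

text \<open>The payment sum collapses to the price of the unique winning round. The case distinction
  on \<open>E\<close> remains because a misreporting buyer may win an item that is worthless to
  her.\<close>

lemma utility_explore_exploit_assigned: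
  assumes sel: "selection_rule sel"
    and j: "assigned (explore_exploit n sel (k, t) b m) i = Some j"
  shows "utility E v (explore_exploit n sel (k, t) b m) i =
    (if (i, j) \<in> E then v i else 0) - ee_price n k t b (explore_exploit n sel (k, t) b j)"
proof -
  let ?h = "explore_exploit n sel (k, t) b m"
  have jm: "j < m" and win: "ee_winner n sel k t b (explore_exploit n sel (k, t) b j) = Some i"
    using j assigned_explore_exploit_iff[OF sel, of n k t b m i j] by simp_all
  have w: "snd (?h ! l) = Some i \<longleftrightarrow> l = j" if "l < m" for l
  proof -
    have "snd (?h ! l) = ee_winner n sel k t b (explore_exploit n sel (k, t) b l)"
      using that by (simp add: explore_exploit_nth)
    then show ?thesis
      using win explore_exploit_winner_unique[OF sel _ win, of l] by auto
  qed
  have "payment ?h i = (\<Sum>l<m. if l = j then fst (?h ! l) else 0)"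
    unfolding payment_def by (intro sum.cong) (auto simp: w)
  also have "\<dots> = ee_price n k t b (explore_exploit n sel (k, t) b j)"
    using jm by (simp add: explore_exploit_nth)
  finally have "payment ?h i = ee_price n k t b (explore_exploit n sel (k, t) b j)" .
  with j show ?thesis
    by (simp add: utility_def obtained_def)
qed

lemma truthful_winner:
  assumes sel: "selection_rule sel"
    and "ee_winner n sel k t b (explore_exploit n sel (k, t) b j) = Some i"
    and "b i = truthful_report E v i"
  shows "(i, j) \<in> E" "ee_price n k t b (explore_exploit n sel (k, t) b j) \<le> v i"
  using ee_winner_in_cands[OF assms(1,2)] assms(3)
  by (auto simp: ee_cands_def truthful_report_def split: if_splits)

lemma explore_exploit_truthful_utility_nonneg:
  assumes sel: "selection_rule sel" and b: "b i = truthful_report E v i"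
  shows "0 \<le> utility E v (explore_exploit n sel (k, t) b m) i"
proof (cases "assigned (explore_exploit n sel (k, t) b m) i")
  case None
  then show ?thesis by (simp add: utility_unassigned)
next
  case (Some j)
  then have "ee_winner n sel k t b (explore_exploit n sel (k, t) b j) = Some i"
    using assigned_explore_exploit_iff[OF sel] by blast
  from truthful_winner[OF sel this b] show ?thesis
    by (simp add: utility_explore_exploit_assigned[OF sel Some])
qed

section \<open>Effect of a deviation by one Exploit buyer\<close>

lemma ee_price_cong:
  assumes "\<And>l. t l = Explore \<Longrightarrow> b l = b' l"
  shows "ee_price n k t b h = ee_price n k t b' h"
  unfolding ee_price_def by (simp add: assms cong: conj_cong)

lemma ee_price_update_Exploit:
  assumes "t i = Exploit"
  shows "ee_price n k t (b(i := d)) h = ee_price n k t (b(i := d')) h"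
  by (rule ee_price_cong) (use assms in auto)

lemma ee_cands_update:
  assumes "t i = Exploit"
  shows "ee_cands n k t (b(i := d)) h - {i} = ee_cands n k t (b(i := d')) h - {i}"
    and "ee_gainers n k t (b(i := d)) h - {i} = ee_gainers n k t (b(i := d')) h - {i}"
proof -
  \<comment> \<open>Both bids of \<open>i\<close> lead to the same price. Hiding it behind one name
    leaves conditions on the other buyers that no longer mention the bid of
    \<open>i\<close>.\<close>
  define q where "q = ee_price n k t (b(i := d')) h"
  then have "ee_price n k t (b(i := d)) h = q"
    using ee_price_update_Exploit[of t i n k b d h d'] assms by simp
  then show "ee_cands n k t (b(i := d)) h - {i} = ee_cands n k t (b(i := d')) h - {i}"
    and "ee_gainers n k t (b(i := d)) h - {i} = ee_gainers n k t (b(i := d')) h - {i}"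
    unfolding ee_cands_def ee_gainers_def q_def[symmetric]
    by (auto simp del: fun_upd_apply simp: fun_upd_other)
qed

text \<open>The first half of \<open>consistent\<close>, with \<open>i\<close> removed from the
  candidates: a losing buyer can be struck out, so the winner is a function of the others
  alone.\<close>

lemma ee_winner_drop_candidate:
  assumes sel: "selection_rule sel" "consistent sel"
    and w: "ee_winner n sel k t b h \<noteq> Some i"
  shows "ee_winner n sel k t b h =
    (if ee_cands n k t b h - {i} = {} then None
     else Some (sel h (ee_cands n k t b h - {i}) (ee_gainers n k t b h - {i})))"
proof (cases "ee_winner n sel k t b h")
  case None
  then show ?thesis by (auto simp: ee_winner_def split: if_splits)
next
  case (Some x)
  let ?C = "ee_cands n k t b h" and ?S = "ee_gainers n k t b h"
  have x: "x \<in> ?C - {i}" "x = sel h ?C ?S"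
    using ee_winner_in_cands[OF sel(1) Some] w Some by (auto simp: ee_winner_def split: if_splits)
  have "sel h (?C - {i}) (?S \<inter> (?C - {i})) = sel h ?C ?S"
    using sel(2)[unfolded consistent_def, THEN conjunct1, rule_format, of ?C ?S "?C - {i}" h]
      x finite_ee_cands[of n k t b h] ee_gainers_subset[of n k t b h] by simp
  moreover have "?S \<inter> (?C - {i}) = ?S - {i}"
    using ee_gainers_subset by blast
  ultimately show ?thesis
    using Some x by auto
qed

text \<open>Equal histories make the other buyers bid equally, even if they react to what was
  announced. With \<open>i\<close> losing in both runs, she can be struck out of both, so the next
  entries agree as well.\<close>

lemma explore_exploit_agree:
  assumes sel: "selection_rule sel" "consistent sel" and t: "t i = Exploit"
    and "assigned (explore_exploit n sel (k, t) (b(i := d)) m) i = None"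
    and "assigned (explore_exploit n sel (k, t) (b(i := d')) m) i = None"
  shows "explore_exploit n sel (k, t) (b(i := d)) m = explore_exploit n sel (k, t) (b(i := d')) m"
  using assms(4,5)
proof (induction m)
  case (Suc m)
  let ?h = "explore_exploit n sel (k, t) (b(i := d)) m"
  have eq: "explore_exploit n sel (k, t) (b(i := d')) m = ?h"
    using Suc.IH Suc.prems unfolding assigned_explore_exploit_None_iff
    by (metis less_SucI)
  have w: "ee_winner n sel k t (b(i := d)) ?h \<noteq> Some i"
    "ee_winner n sel k t (b(i := d')) ?h \<noteq> Some i"
    using Suc.prems eq unfolding assigned_explore_exploit_None_iff by (metis lessI)+
  have "ee_winner n sel k t (b(i := d)) ?h = ee_winner n sel k t (b(i := d')) ?h"
    unfolding ee_winner_drop_candidate[OF sel w(1)] ee_winner_drop_candidate[OF sel w(2)]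
      ee_cands_update[of t i n k b d ?h d', OF t] by (rule refl)
  then show ?case
    using ee_price_update_Exploit[of t i n k b d ?h d'] t
    by (simp add: explore_exploit_Suc Let_def eq del: fun_upd_apply)
qed simp

text \<open>The only possible change is that \<open>i\<close> joins the gainers, and by the second
  half of \<open>consistent\<close> this cannot cost her the item. The strict inequality matters: a
  bid equal to the price could remove her from the gainers.\<close>

lemma ee_winner_raise_bid:
  assumes sel: "selection_rule sel" "consistent sel" and t: "t i = Exploit"
    and w: "ee_winner n sel k t (b(i := d)) h = Some i"
    and d': "d' h = Some w'" "ee_price n k t (b(i := d)) h < w'"
  shows "ee_winner n sel k t (b(i := d')) h = Some i"
proof -
  let ?C = "ee_cands n k t (b(i := d)) h" and ?S = "ee_gainers n k t (b(i := d)) h"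
  let ?C' = "ee_cands n k t (b(i := d')) h" and ?S' = "ee_gainers n k t (b(i := d')) h"
  have i: "i \<in> ?C" "sel h ?C ?S = i"
    using ee_winner_in_cands[OF sel(1) w] w by (auto simp: ee_winner_def split: if_splits)
  have p: "ee_price n k t (b(i := d')) h = ee_price n k t (b(i := d)) h"
    by (rule ee_price_update_Exploit[where i = i]) (rule t)
  have i': "i \<in> ?C'" "i \<in> ?S'"
    using i(1) d' by (auto simp: ee_cands_def ee_gainers_def p)
  have eq: "?C' = ?C" "?S' = insert i ?S"
    using ee_cands_update[of t i n k b d h d', OF t] i(1) i' by blast+
  have "sel h ?C (insert i ?S) = i"
    using sel(2)[unfolded consistent_def, THEN conjunct2, rule_format, of ?C ?S i h]
      i finite_ee_cands[of n k t "b(i := d)" h] ee_gainers_subset[of n k t "b(i := d)" h] by simp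
  then show ?thesis
    using i(1) by (auto simp: ee_winner_def eq)
qed

lemma explore_exploit_deviation:
  assumes sel: "selection_rule sel" "consistent sel"
  shows "utility E v (explore_exploit n sel (k, t) (b(i := d)) m) i
    \<le> utility E v (explore_exploit n sel (k, t) (b(i := truthful_report E v i)) m) i"
proof -
  define A where "A = explore_exploit n sel (k, t) (b(i := d))"
  define B where "B = explore_exploit n sel (k, t) (b(i := truthful_report E v i))"
  define wA where "wA j = ee_winner n sel k t (b(i := d)) (A j)" for j
  define wB where "wB j = ee_winner n sel k t (b(i := truthful_report E v i)) (B j)" for j
  define pA where "pA j = ee_price n k t (b(i := d)) (A j)" for j
  define pB where "pB j = ee_price n k t (b(i := truthful_report E v i)) (B j)" for j
  note defs = A_def B_def wA_def wB_def pA_def pB_def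
  have B0: "0 \<le> utility E v (B m) i"
    unfolding B_def by (rule explore_exploit_truthful_utility_nonneg[OF sel(1)]) simp
  have noneA: "assigned (A m) i = None \<longleftrightarrow> (\<forall>j<m. wA j \<noteq> Some i)" for m
    by (simp add: defs assigned_explore_exploit_None_iff)
  have noneB: "assigned (B m) i = None \<longleftrightarrow> (\<forall>j<m. wB j \<noteq> Some i)" for m
    by (simp add: defs assigned_explore_exploit_None_iff)
  have utilA: "utility E v (A m) i = (if (i, j) \<in> E then v i else 0) - pA j"
    if "j < m" "wA j = Some i" for j
    using utility_explore_exploit_assigned[OF sel(1)] assigned_explore_exploit_iff[OF sel(1)] that
    by (simp add: defs)
  have utilB: "utility E v (B m) i = (if (i, j) \<in> E then v i else 0) - pB j"
    if "j < m" "wB j = Some i" for j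
    using utility_explore_exploit_assigned[OF sel(1)] assigned_explore_exploit_iff[OF sel(1)] that
    by (simp add: defs)
  have "utility E v (A m) i \<le> utility E v (B m) i"
  proof (cases "assigned (A m) i = None")
    case True
    then show ?thesis using B0 by (simp add: utility_unassigned)
  next
    case False
    then obtain ja where ja: "ja < m" "wA ja = Some i"
      using noneA[of m] by auto
    then have "i \<in> ee_cands n k t (b(i := d)) (A ja)"
      using ee_winner_in_cands[OF sel(1)] unfolding wA_def by blast
    \<comment> \<open>Explore buyers are never served, so a deviation that wins something forces
      this type.\<close>
    then have t: "t i = Exploit"
      by (simp add: ee_cands_def)
    \<comment> \<open>The first round in which \<open>i\<close> wins in either run; up to here the
      histories, and hence the prices at \<open>j\<close>, coincide.\<close>
    define j where "j = (LEAST j. wA j = Some i \<or> wB j = Some i)"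
    have j: "wA j = Some i \<or> wB j = Some i"
      unfolding j_def by (rule LeastI[of _ ja]) (simp add: ja)
    have j_le: "j \<le> ja"
      unfolding j_def by (rule Least_le) (simp add: ja)
    have before: "wA l \<noteq> Some i" "wB l \<noteq> Some i" if "l < j" for l
      using not_less_Least[of l "\<lambda>j. wA j = Some i \<or> wB j = Some i"] that
      by (auto simp: j_def)
    have "assigned (A j) i = None" "assigned (B j) i = None"
      by (simp_all add: noneA noneB before)
    then have AB: "A j = B j"
      using explore_exploit_agree[of sel t i n k b d j "truthful_report E v i", OF sel t]
      by (simp only: A_def B_def)
    have p: "pA j = pB j"
      using ee_price_update_Exploit[of t i n k b d "A j" "truthful_report E v i"] t
      by (simp add: pA_def pB_def AB)
    have pos: "0 \<le> pA j"
      unfolding pA_def A_def by (rule ee_price_nonneg)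
    show ?thesis
    proof (cases "wB j = Some i")
      \<comment> \<open>The truthful run wins an item of value \<open>v i\<close> at price
        \<open>pB j\<close>. The deviation wins in round \<open>ja\<close>, not before
        \<open>j\<close>, so it pays at least as much for at most the same value.\<close>
      case True
      have "(i, j) \<in> E" "pB j \<le> v i"
        using truthful_winner[OF sel(1), of n k t "b(i := truthful_report E v i)" j i E v] True
        by (auto simp: defs)
      moreover have "pA j \<le> pA ja"
        unfolding pA_def A_def by (rule ee_price_mono[OF j_le])
      ultimately show ?thesis
        using utilA[OF ja] utilB[of j] True j_le ja(1) p pos by auto
    next
      case False
      with j have wA: "wA j = Some i" by simp
      \<comment> \<open>Only the deviation wins \<open>j\<close>. A strict gain there would mean
        that the truthful bid exceeds the price, and then it would win too.\<close>
      have "\<not> ((i, j) \<in> E \<and> pA j < v i)"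
      proof
        assume a: "(i, j) \<in> E \<and> pA j < v i"
        have "truthful_report E v i (A j) = Some (v i)"
          using a by (simp add: truthful_report_def A_def)
        then have "ee_winner n sel k t (b(i := truthful_report E v i)) (A j) = Some i"
          using ee_winner_raise_bid[of sel t i n k b d "A j" "truthful_report E v i", OF sel t] wA a
          by (simp add: wA_def pA_def)
        with False show False
          by (simp add: wB_def AB)
      qed
      then have "utility E v (A m) i \<le> 0"
        using utilA[OF _ wA] j_le ja(1) pos by auto
      with B0 show ?thesis by linarith
    qed
  qed
  then show ?thesis
    by (simp add: A_def B_def)
qed

lemma explore_exploit_truthful:
  assumes "selection_rule sel" "consistent sel"
  shows "truthful n (ee_seed n) (explore_exploit n sel)"
  unfolding truthful_def by (clarify, rule explore_exploit_deviation[OF assms])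

lemma explore_exploit_individually_rational:
  assumes "selection_rule sel"
  shows "individually_rational n (ee_seed n) (explore_exploit n sel)"
  unfolding individually_rational_def
  by (clarify, rule explore_exploit_truthful_utility_nonneg[OF assms], rule fun_upd_same)

subsection \<open>Optimal matchings and posted prices\<close>

text \<open>Ensures that the \<open>Max\<close> in \<open>opt\<close> is attained.\<close>

lemma finite_matchings: "finite {\<mu>. matching n E \<mu>}" if "market n m E v"
proof (rule finite_subset)
  show "{\<mu>. matching n E \<mu>} \<subseteq> {\<mu>. dom \<mu> \<subseteq> {..<n} \<and> ran \<mu> \<subseteq> {..<m}}"
    using that by (force simp: matching_def market_def ran_def)
  have "{\<mu>. dom \<mu> \<subseteq> {..<n} \<and> ran \<mu> \<subseteq> {..<m}} =
    (\<Union>D\<in>Pow {..<n}. {\<mu>. dom \<mu> = D \<and> ran \<mu> \<subseteq> {..<m}})"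
    by auto
  also have "finite \<dots>"
    by (intro finite_UN_I finite_set_of_finite_maps) (auto intro: finite_subset)
  finally show "finite {\<mu>. dom \<mu> \<subseteq> {..<n} \<and> ran \<mu> \<subseteq> {..<m :: nat}}" .
qed

lemma social_welfare_matching:
  assumes "matching n E \<mu>"
  shows "social_welfare n E v \<mu> = sum v (dom \<mu>)"
proof -
  have "obtained E v \<mu> i = (if i \<in> dom \<mu> then v i else 0)" for i
    using assms by (auto simp: obtained_def matching_def)
  moreover have "{..<n} \<inter> dom \<mu> = dom \<mu>"
    using assms by (auto simp: matching_def)
  ultimately show ?thesis
    by (simp add: social_welfare_def sum.If_cases Int_def)
qed

lemma opt_attained:
  assumes "market n m E v"
  obtains \<mu> where "matching n E \<mu>" "opt n E v = sum v (dom \<mu>)"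
proof -
  have "matching n E Map.empty"
    by (simp add: matching_def)
  then have "opt n E v \<in> social_welfare n E v ` {\<mu>. matching n E \<mu>}"
    unfolding opt_def using finite_matchings[OF assms] by (intro Max_in) auto
  with that show ?thesis
    using social_welfare_matching by auto
qed

text \<open>The explored maximum before division by \<open>2 ^ k\<close>. It refers neither to
  \<open>k\<close> nor to a history, so one type profile can be studied for all scales at once. The
  inserted 0 is the initial price.\<close>

definition top_explored ::
    "nat \<Rightarrow> (nat \<times> nat) set \<Rightarrow> (nat \<Rightarrow> real) \<Rightarrow> (nat \<Rightarrow> buyer_type) \<Rightarrow> nat \<Rightarrow> real" where
  "top_explored n E v t j = Max (insert 0 (v ` {l. l < n \<and> t l = Explore \<and> (\<exists>j'\<le>j. (l, j') \<in> E)}))"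

lemma top_explored_ge:
  assumes "l < n" "t l = Explore" "(l, j') \<in> E" "j' \<le> j"
  shows "v l \<le> top_explored n E v t j"
  unfolding top_explored_def using assms by (intro Max_ge) auto

lemma top_explored_le:
  assumes "0 \<le> c" "\<And>l j'. (l, j') \<in> E \<Longrightarrow> v l \<le> c"
  shows "top_explored n E v t j \<le> c"
  unfolding top_explored_def using assms by (subst Max_le_iff) auto

lemma top_explored_nonneg: "0 \<le> top_explored n E v t j"
  unfolding top_explored_def by (intro Max_ge) auto

text \<open>Division by \<open>2 ^ k\<close> is monotone and commutes with \<open>Max\<close>;
  \<open>c\<close> is the unscaled running maximum carried over from the previous round.\<close>

lemma ee_price_truthful_Max:
  assumes "length h = j" "current_price h = c / 2 ^ k"
  shows "ee_price n k t (truthful_report E v) h =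
    Max (insert c (v ` {l. l < n \<and> t l = Explore \<and> (l, j) \<in> E})) / 2 ^ k"
proof -
  let ?A = "{l. l < n \<and> t l = Explore \<and> (l, j) \<in> E}"
  have "{w / 2 ^ k | l w. l < n \<and> t l = Explore \<and> truthful_report E v l h = Some w} =
    (\<lambda>x. x / 2 ^ k) ` v ` ?A"
    using assms(1) by (force simp: truthful_report_def split: if_splits)
  then have "ee_price n k t (truthful_report E v) h = Max ((\<lambda>x. x / 2 ^ k) ` insert c (v ` ?A))"
    by (simp add: ee_price_def assms(2))
  also have "\<dots> = Max (insert c (v ` ?A)) / 2 ^ k"
    by (rule mono_Max_commute[symmetric]) (auto intro!: monoI divide_right_mono)
  finally show ?thesis .
qed

lemma Max_Un_insert:
  fixes A B :: "'a :: linorder set"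
  assumes "finite A" "A \<noteq> {}" "finite B"
  shows "Max (A \<union> B) = Max (insert (Max A) B)"
  using assms by (cases "B = {}") (simp_all add: Max_Un)

text \<open>Truthful bids do not react to the history, so the running maximum is the maximum over
  all edges of Explore buyers seen so far.\<close>

lemma ee_price_truthful:
  "ee_price n k t (truthful_report E v) (explore_exploit n sel (k, t) (truthful_report E v) j) =
     top_explored n E v t j / 2 ^ k"
proof (induction j)
  case 0
  show ?case
    using ee_price_truthful_Max[of "[]" 0 0 k n t E v]
    by (simp add: current_price_def top_explored_def)
next
  case (Suc j)
  let ?A = "\<lambda>j. {l. l < n \<and> t l = Explore \<and> (l, j) \<in> E}"
  let ?U = "\<lambda>j. {l. l < n \<and> t l = Explore \<and> (\<exists>j'\<le>j. (l, j') \<in> E)}"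
  have "?U (Suc j) = ?U j \<union> ?A (Suc j)"
    by (auto simp: le_Suc_eq)
  then have "top_explored n E v t (Suc j) = Max (insert 0 (v ` ?U j) \<union> v ` ?A (Suc j))"
    by (simp add: top_explored_def image_Un)
  also have "\<dots> = Max (insert (top_explored n E v t j) (v ` ?A (Suc j)))"
    unfolding top_explored_def
    by (rule Max_Un_insert) auto
  finally show ?case
    using ee_price_truthful_Max[OF _ trans[OF current_price_Suc Suc.IH]] by simp
qed

section \<open>Welfare for one fixed seed\<close>

lemma obtained_nonneg:
  assumes "market n m E v" "i < n"
  shows "0 \<le> obtained E v \<mu> i"
  using assms by (simp add: obtained_def market_def)

lemma obtained_le_social_welfare:
  assumes "market n m E v" "i < n"
  shows "obtained E v \<mu> i \<le> social_welfare n E v \<mu>"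
  unfolding social_welfare_def
  by (rule member_le_sum) (use assms obtained_nonneg in auto)

lemma social_welfare_nonneg:
  assumes "market n m E v"
  shows "0 \<le> social_welfare n E v \<mu>"
  unfolding social_welfare_def by (rule sum_nonneg) (use assms obtained_nonneg in auto)

lemma truthful_assigned:
  assumes sel: "selection_rule sel"
    and "assigned (explore_exploit n sel (k, t) (truthful_report E v) m) l = Some j"
  shows "l < n" "t l = Exploit" "(l, j) \<in> E" "top_explored n E v t j / 2 ^ k \<le> v l"
    and "obtained E v (assigned (explore_exploit n sel (k, t) (truthful_report E v) m)) l = v l"
proof -
  let ?h = "explore_exploit n sel (k, t) (truthful_report E v) j"
  have w: "ee_winner n sel k t (truthful_report E v) ?h = Some l"
    using assms assigned_explore_exploit_iff[OF sel] by blast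
  show "l < n" "t l = Exploit"
    using ee_winner_in_cands[OF sel w] by (auto simp: ee_cands_def)
  show E: "(l, j) \<in> E" and "top_explored n E v t j / 2 ^ k \<le> v l"
    using truthful_winner[OF sel w refl] by (auto simp: ee_price_truthful)
  then show "obtained E v (assigned (explore_exploit n sel (k, t) (truthful_report E v) m)) l = v l"
    using assms(2) by (simp add: obtained_def)
qed

lemma truthful_candidate:
  assumes "(i, j) \<in> E" "i < n" "t i = Exploit" "top_explored n E v t j / 2 ^ k \<le> v i"
    and "assigned (explore_exploit n sel (k, t) (truthful_report E v) j) i = None"
  shows "i \<in> ee_cands n k t (truthful_report E v)
    (explore_exploit n sel (k, t) (truthful_report E v) j)"
  using assms by (simp add: ee_cands_def truthful_report_def ee_price_truthful)

text \<open>An item stays unsold only if there are no candidates; an Exploit buyer who wants and can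
  afford it fails to be one only by already having an item.\<close>

lemma explore_exploit_maximal:
  assumes sel: "selection_rule sel" and mkt: "market n m E v" and ij: "(i, j) \<in> E"
    and t: "t i = Exploit" and p: "top_explored n E v t j / 2 ^ k \<le> v i"
  shows "assigned (explore_exploit n sel (k, t) (truthful_report E v) m) i \<noteq> None \<or>
    (\<exists>l. assigned (explore_exploit n sel (k, t) (truthful_report E v) m) l = Some j)"
proof (rule disjCI)
  let ?b = "truthful_report E v"
  let ?h = "explore_exploit n sel (k, t) ?b j"
  assume unsold: "\<not> (\<exists>l. assigned (explore_exploit n sel (k, t) ?b m) l = Some j)"
  have lt: "i < n" "j < m"
    using mkt ij by (auto simp: market_def)
  have "ee_winner n sel k t ?b ?h = None"
    using unsold lt(2) assigned_explore_exploit_iff[OF sel, of n k t ?b m] by (metis not_Some_eq)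
  then have "i \<notin> ee_cands n k t ?b ?h"
    by (auto simp: ee_winner_def split: if_splits)
  then obtain j' where "assigned ?h i = Some j'"
    using truthful_candidate[OF ij lt(1) t p] by blast
  then have "assigned (explore_exploit n sel (k, t) ?b m) i = Some j'"
    using lt(2) assigned_explore_exploit_iff[OF sel] by auto
  then show "assigned (explore_exploit n sel (k, t) ?b m) i \<noteq> None"
    by simp
qed

lemma posted_price_charging:
  assumes sel: "selection_rule sel" and mkt: "market n m E v" and \<mu>: "matching n E \<mu>"
  shows "(\<Sum>i\<in>dom \<mu>. if t i = Exploit \<and> top_explored n E v t (the (\<mu> i)) / 2 ^ k \<le> v i
                      then top_explored n E v t (the (\<mu> i)) / 2 ^ k else 0)
    \<le> 2 * social_welfare n E v (assigned (explore_exploit n sel (k, t) (truthful_report E v) m))"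
proof -
  define p where "p j = top_explored n E v t j / 2 ^ k" for j
  define \<nu> where "\<nu> = assigned (explore_exploit n sel (k, t) (truthful_report E v) m)"
  define g where "g l = obtained E v \<nu> l" for l
  have dom: "dom \<mu> \<subseteq> {..<n}" "inj_on \<mu> (dom \<mu>)"
    using \<mu> by (auto simp: matching_def)
  have fin: "finite (dom \<mu>)"
    using finite_subset[OF dom(1)] by simp
  have g0: "0 \<le> g l" if "l < n" for l
    unfolding g_def by (rule obtained_nonneg[OF mkt that])
  \<comment> \<open>Buyer \<open>i\<close> charges herself if she is served, and otherwise the
    holder of her optimal item. As \<open>\<mu> i\<close> is a \<open>Some\<close>, unserved
    \<open>l\<close> never match in the sum.\<close>
  have charge: "(if t i = Exploit \<and> p (the (\<mu> i)) \<le> v i then p (the (\<mu> i)) else 0)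
    \<le> g i + (\<Sum>l<n. if \<nu> l = \<mu> i then g l else 0)" (is "_ \<le> _ + ?s") if i: "i \<in> dom \<mu>" for i
  proof -
    obtain j where j: "\<mu> i = Some j" "(i, j) \<in> E" "i < n"
      using i \<mu> dom(1) by (auto simp: matching_def)
    have s0: "0 \<le> ?s"
      by (rule sum_nonneg) (simp add: g0)
    show ?thesis
    proof (cases "t i = Exploit \<and> p j \<le> v i")
      case False
      then show ?thesis using s0 g0 j by auto
    next
      case True
      then consider "\<nu> i \<noteq> None" | l where "\<nu> l = Some j"
        using explore_exploit_maximal[OF sel mkt j(2), of t k] unfolding \<nu>_def p_def by blast
      then show ?thesis
      proof cases
        case 1
        then have "g i = v i"
          using truthful_assigned(5)[OF sel, of n k t E v m i] by (auto simp: g_def \<nu>_def)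
        then show ?thesis using True j s0 by simp
      next
        case 2
        then have l: "l < n" "p j \<le> g l"
          using truthful_assigned[OF sel, of n k t E v m l j] by (auto simp: g_def \<nu>_def p_def)
        have "g l \<le> ?s"
          using member_le_sum[of l "{..<n}" "\<lambda>l. if \<nu> l = \<mu> i then g l else 0"] l(1) 2 j(1)
          by (simp add: g0)
        then show ?thesis using True j l g0 by fastforce
      qed
    qed
  qed
  \<comment> \<open>\<open>\<mu>\<close> is injective, so the item of \<open>l\<close> is the
    optimal item of at most one buyer.\<close>
  have once: "(\<Sum>i\<in>dom \<mu>. if \<nu> l = \<mu> i then g l else 0) \<le> g l" if l: "l < n" for l
  proof (cases "\<exists>i\<in>dom \<mu>. \<nu> l = \<mu> i")
    case True
    then obtain i where i: "i \<in> dom \<mu>" "\<nu> l = \<mu> i" by blast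
    have "(\<Sum>i'\<in>dom \<mu>. if \<nu> l = \<mu> i' then g l else 0) = (\<Sum>i'\<in>dom \<mu>. if i' = i then g l else 0)"
      using i dom(2) by (intro sum.cong) (auto dest: inj_onD)
    then show ?thesis using fin i by simp
  next
    case False
    then have "(\<Sum>i\<in>dom \<mu>. if \<nu> l = \<mu> i then g l else 0) = 0"
      by (intro sum.neutral) auto
    then show ?thesis using g0[OF l] by simp
  qed
  have "(\<Sum>i\<in>dom \<mu>. if t i = Exploit \<and> p (the (\<mu> i)) \<le> v i then p (the (\<mu> i)) else 0)
    \<le> (\<Sum>i\<in>dom \<mu>. g i) + (\<Sum>i\<in>dom \<mu>. \<Sum>l<n. if \<nu> l = \<mu> i then g l else 0)"
    unfolding sum.distrib[symmetric] by (rule sum_mono) (rule charge)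
  also have "(\<Sum>i\<in>dom \<mu>. g i) \<le> sum g {..<n}"
    by (rule sum_mono2) (use dom(1) g0 in auto)
  also have "(\<Sum>i\<in>dom \<mu>. \<Sum>l<n. if \<nu> l = \<mu> i then g l else 0) \<le> sum g {..<n}"
    by (subst sum.swap) (intro sum_mono once, simp)
  finally show ?thesis
    unfolding p_def \<nu>_def g_def social_welfare_def by simp
qed

text \<open>If \<open>i\<close> is still free when \<open>j\<close> arrives, she can afford it, and
  \<open>j\<close> goes to some \<open>x\<close>. If \<open>x\<close> were worth less than
  \<open>i\<close>, an explored rival of at least her value would force her value to equal the
  price. Distinct values exclude this tie, and \<open>gainers_first\<close> would prefer
  \<open>i\<close>.\<close>

lemma top_buyer_served:
  assumes sel: "selection_rule sel" and mkt: "market n m E v"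
    and ties: "gainers_first sel \<or> inj_on v {..<n}"
    and ij: "(i, j) \<in> E" and t: "t i = Exploit"
    and top: "\<And>l j'. (l, j') \<in> E \<Longrightarrow> v l \<le> v i"
    and rival: "\<And>l. (l, j) \<in> E \<Longrightarrow> l \<noteq> i \<Longrightarrow> \<exists>r. t r = Explore \<and> (r, j) \<in> E \<and> v l \<le> v r"
  shows "v i \<le> social_welfare n E v (assigned (explore_exploit n sel (0, t) (truthful_report E v) m))"
proof -
  let ?b = "truthful_report E v"
  let ?h = "explore_exploit n sel (0, t) ?b j" and ?\<nu> = "assigned (explore_exploit n sel (0, t) ?b m)"
  let ?C = "ee_cands n 0 t ?b ?h" and ?S = "ee_gainers n 0 t ?b ?h"
  have lt: "i < n" "j < m"
    using mkt ij by (auto simp: market_def)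
  have p: "top_explored n E v t j \<le> v i"
    by (rule top_explored_le) (use mkt lt top in \<open>auto simp: market_def\<close>)
  have "\<exists>x j'. ?\<nu> x = Some j' \<and> v i \<le> v x"
  proof (cases "assigned ?h i = None")
    case False
    then obtain j' where "assigned ?h i = Some j'" by blast
    then have "?\<nu> i = Some j'"
      using assigned_explore_exploit_iff[OF sel] lt(2) by auto
    then show ?thesis by auto
  next
    case True
    have i: "i \<in> ?C"
      using truthful_candidate[OF ij lt(1) t _ True] p by simp
    define x where "x = sel ?h ?C ?S"
    have x: "x = sel ?h ?C ?S" "ee_winner n sel 0 t ?b ?h = Some x"
      using i by (auto simp: x_def ee_winner_def)
    have \<nu>: "?\<nu> x = Some j"
      using x(2) lt(2) assigned_explore_exploit_iff[OF sel] by blast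
    note xs = truthful_assigned[OF sel \<nu>]
    have "v i \<le> v x"
    proof (rule ccontr)
      assume less: "\<not> v i \<le> v x"
      then obtain r where r: "t r = Explore" "(r, j) \<in> E" "v x \<le> v r"
        using rival[OF xs(3)] by auto
      have "r < n" "x \<noteq> r"
        using r xs(2) mkt by (auto simp: market_def)
      \<comment> \<open>With \<open>k = 0\<close> the price is \<open>top_explored\<close> itself:
        at least \<open>v r\<close>, at most \<open>v x\<close>, while
        \<open>v x \<le> v r\<close>.\<close>
      have eq: "v x = top_explored n E v t j" "v x = v r"
        using top_explored_ge[of r n t j E j v] \<open>r < n\<close> r xs(4) by auto
      have "\<not> inj_on v {..<n}"
        using eq(2) \<open>r < n\<close> \<open>x \<noteq> r\<close> xs(1) by (auto dest: inj_onD)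
      with ties have "gainers_first sel" by blast
      moreover have "i \<in> ?S"
        using i less ij eq(1) by (simp add: ee_gainers_def truthful_report_def ee_price_truthful)
      ultimately have "x \<in> ?S"
        using finite_ee_cands ee_gainers_subset unfolding x(1) gainers_first_def by (metis empty_iff)
      then show False
        using eq(1) by (auto simp: ee_gainers_def truthful_report_def ee_price_truthful split: if_splits)
    qed
    with \<nu> show ?thesis by blast
  qed
  then obtain x j' where x: "?\<nu> x = Some j'" "v i \<le> v x" by blast
  show ?thesis
    using obtained_le_social_welfare[OF mkt truthful_assigned(1)[OF sel x(1)], of ?\<nu>]
      truthful_assigned(5)[OF sel x(1)] x(2) by simp
qed

subsection \<open>The random seed\<close>

abbreviation type_pmf :: "nat \<Rightarrow> (nat \<Rightarrow> buyer_type) pmf" where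
  "type_pmf n \<equiv> Pi_pmf {..<n} Exploit (\<lambda>_. pmf_of_set {Explore, Exploit})"

text \<open>Independent fair coins on the coordinates in \<open>A\<close>. These must lie below
  \<open>n\<close>, as all other coordinates have the fixed default \<open>Exploit\<close>.\<close>

lemma prob_types:
  assumes "A \<subseteq> {..<n}"
  shows "measure_pmf.prob (type_pmf n) {t. \<forall>l\<in>A. t l = c l} = (1 / 2) ^ card A"
proof -
  have UN: "(UNIV :: buyer_type set) = {Explore, Exploit}"
    using buyer_type.exhaust by auto
  have eq: "{t. \<forall>l\<in>A. t l = c l} = Pi {..<n} (\<lambda>l. if l \<in> A then {c l} else UNIV)"
    using assms by (auto simp: Pi_def split: if_splits)
  have half: "measure_pmf.prob (pmf_of_set {Explore, Exploit}) {x} = 1 / 2" for x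
    by (cases x) (simp_all add: measure_pmf_single)
  have "measure_pmf.prob (type_pmf n) {t. \<forall>l\<in>A. t l = c l} =
    (\<Prod>l<n. if l \<in> A then 1 / 2 else 1)"
    unfolding eq by (subst measure_Pi_pmf_Pi) (auto intro!: prod.cong simp: half)
  also have "\<dots> = (1 / 2) ^ card A"
    using assms by (simp add: prod.If_cases Int_absorb1)
  finally show ?thesis .
qed

text \<open>The scale \<open>k\<close> is uniform and independent of the types, so a good
  \<open>k\<close> that may vary with \<open>t\<close> is hit with probability at least one over the
  number of scales.\<close>

lemma prob_seed_ge:
  assumes "\<And>t. t \<in> T \<Longrightarrow> \<exists>k\<le>nat \<lceil>log 2 (real n)\<rceil>. (k, t) \<in> S"
  shows "measure_pmf.prob (type_pmf n) T / (nat \<lceil>log 2 (real n)\<rceil> + 1) \<le> measure_pmf.prob (ee_seed n) S"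
proof -
  define K where "K = nat \<lceil>log 2 (real n)\<rceil>"
  \<comment> \<open>Restricting to the support makes the slice countable, as the product formula
    requires.\<close>
  define Sk where "Sk k = {t \<in> set_pmf (type_pmf n). (k, t) \<in> S}" for k
  have slice: "measure_pmf.prob (ee_seed n) ({k} \<times> Sk k) = measure_pmf.prob (type_pmf n) (Sk k) / (K + 1)"
    if "k \<le> K" for k
  proof -
    have "measure_pmf.prob (pmf_of_set {0..K}) {k} = 1 / (K + 1)"
      using that by (simp add: measure_pmf_single add.commute)
    moreover have "countable (Sk k)"
      by (rule countable_subset[OF _ countable_set_pmf]) (auto simp: Sk_def)
    then have "measure_pmf.prob (ee_seed n) ({k} \<times> Sk k) =
      measure_pmf.prob (pmf_of_set {0..K}) {k} * measure_pmf.prob (type_pmf n) (Sk k)"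
      unfolding ee_seed_def K_def by (intro measure_pmf_prob_product) simp
    ultimately show ?thesis by simp
  qed
  have "measure_pmf.prob (type_pmf n) T = measure_pmf.prob (type_pmf n) (T \<inter> set_pmf (type_pmf n))"
    by (simp add: measure_Int_set_pmf)
  also have "\<dots> \<le> measure_pmf.prob (type_pmf n) (\<Union>k\<in>{..K}. Sk k)"
    by (rule measure_pmf.finite_measure_mono) (use assms in \<open>auto simp: Sk_def K_def\<close>)
  also have "\<dots> \<le> (\<Sum>k\<le>K. measure_pmf.prob (type_pmf n) (Sk k))"
    by (rule measure_pmf.finite_measure_subadditive_finite) auto
  also have "\<dots> / (K + 1) = (\<Sum>k\<le>K. measure_pmf.prob (ee_seed n) ({k} \<times> Sk k))"
    by (simp add: slice sum_divide_distrib)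
  \<comment> \<open>The slices may overlap in \<open>t\<close>, hence the union bound above; tagged
    with \<open>k\<close> they are disjoint, so here the sum is exact.\<close>
  also have "\<dots> = measure_pmf.prob (ee_seed n) (\<Union>k\<in>{..K}. {k} \<times> Sk k)"
    by (rule measure_pmf.finite_measure_finite_Union[symmetric]) (auto simp: disjoint_family_on_def)
  also have "\<dots> \<le> measure_pmf.prob (ee_seed n) S"
    by (rule measure_pmf.finite_measure_mono) (auto simp: Sk_def)
  finally show ?thesis
    by (simp add: K_def divide_right_mono)
qed

text \<open>Finite support makes every real function of the seed integrable.\<close>

lemma finite_set_ee_seed: "finite (set_pmf (ee_seed n))"
proof -
  have "finite (set_pmf (type_pmf n))"
    by (subst set_Pi_pmf) auto
  then show ?thesis
    by (simp add: ee_seed_def)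
qed

lemma integrable_ee_seed: "integrable (measure_pmf (ee_seed n)) (f :: _ \<Rightarrow> real)"
  by (rule integrable_measure_pmf_finite) (rule finite_set_ee_seed)

text \<open>Linearity of expectation: transfers a charging bound valid for each seed to the expected
  welfare.\<close>

lemma sum_prob_le_expectation_ee_seed:
  assumes "finite D" "\<And>r. (\<Sum>i\<in>D. c i * indicator (S i) r) \<le> f r"
  shows "(\<Sum>i\<in>D. c i * measure_pmf.prob (ee_seed n) (S i)) \<le> measure_pmf.expectation (ee_seed n) f"
proof -
  have "(\<Sum>i\<in>D. c i * measure_pmf.prob (ee_seed n) (S i)) =
    measure_pmf.expectation (ee_seed n) (\<lambda>r. \<Sum>i\<in>D. c i * indicator (S i) r)"
    by (subst Bochner_Integration.integral_sum) (simp_all add: integrable_ee_seed)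
  also have "\<dots> \<le> measure_pmf.expectation (ee_seed n) f"
    by (rule integral_mono) (simp_all add: integrable_ee_seed assms(2))
  finally show ?thesis .
qed

subsection \<open>Approximation\<close>

text \<open>Halve \<open>x\<close> until it first drops to \<open>y\<close> or below: the last
  halving started above \<open>y\<close>, so it ends above \<open>y / 2\<close>. If no halving takes
  place, the lower bound is an assumption.\<close>

lemma dyadic_scale_between:
  fixes x y :: real
  assumes "0 < y" "y / 2 \<le> x" "x \<le> 2 ^ K * y"
  obtains k where "k \<le> K" "y / 2 \<le> x / 2 ^ k" "x / 2 ^ k \<le> y"
proof -
  define k where "k = (LEAST k. x \<le> 2 ^ k * y)"
  have k: "x \<le> 2 ^ k * y"
    unfolding k_def by (rule LeastI[of _ K]) (rule assms(3))
  have le: "k \<le> K"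
    unfolding k_def by (rule Least_le) (rule assms(3))
  have "y / 2 \<le> x / 2 ^ k"
  proof (cases k)
    case 0
    then show ?thesis using assms(2) by simp
  next
    case (Suc k')
    then have "\<not> x \<le> 2 ^ k' * y"
      using not_less_Least[of k' "\<lambda>k. x \<le> 2 ^ k * y"] by (simp add: k_def)
    then show ?thesis
      using Suc by (simp add: field_simps)
  qed
  then show ?thesis
    using that le k by (simp add: field_simps)
qed

text \<open>A geometric series: below the largest value \<open>v x\<close> all others are at most
  \<open>v x / 2\<close>, so by induction they sum to at most \<open>v x\<close>. The bound
  \<open>c\<close> varies in the induction for this reason.\<close>

lemma sum_le_of_doubling:
  fixes v :: "'a \<Rightarrow> real"
  assumes "finite D" "0 \<le> c" "\<And>a. a \<in> D \<Longrightarrow> v a \<le> c"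
    and "\<And>a b. a \<in> D \<Longrightarrow> b \<in> D \<Longrightarrow> a \<noteq> b \<Longrightarrow> v a < v b / 2 \<or> v b < v a / 2"
    and "\<And>a. a \<in> D \<Longrightarrow> 0 \<le> v a"
  shows "sum v D \<le> 2 * c"
  using assms
proof (induction D arbitrary: c rule: finite_ranking_induct[where f = v])
  case (insert x S)
  show ?case
  proof (cases "x \<in> S")
    case True
    then show ?thesis
      using insert.IH[of c] insert.prems by (simp add: insert_absorb)
  next
    case False
    have "v a \<le> v x / 2" if "a \<in> S" for a
      using insert.prems(3)[of a x] insert.prems(4)[of x] insert.hyps(2)[OF that] that False by force
    then have "sum v S \<le> 2 * (v x / 2)"
      using insert.prems by (intro insert.IH) auto
    then show ?thesis
      using False insert.hyps(1) insert.prems(2)[of x] by simp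
  qed
qed simp

section \<open>Expected welfare against the value groups\<close>

lemma expected_welfare_nonneg:
  assumes "market n m E v"
  shows "0 \<le> expected_welfare n R M m E v"
  unfolding expected_welfare_def
  by (rule Bochner_Integration.integral_nonneg) (rule social_welfare_nonneg[OF assms])

lemma top_value_le_expected_welfare:
  assumes sel: "selection_rule sel" and mkt: "market n m E v"
    and ties: "gainers_first sel \<or> inj_on v {..<n}"
    and ij: "(i, j) \<in> E" and top: "\<And>l j'. (l, j') \<in> E \<Longrightarrow> v l \<le> v i"
  shows "v i \<le> 4 * (nat \<lceil>log 2 (real n)\<rceil> + 1) *
    expected_welfare n (ee_seed n) (explore_exploit n sel) m E v"
proof -
  let ?W = "\<lambda>r. social_welfare n E v (assigned (explore_exploit n sel r (truthful_report E v) m))"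
  have lt: "i < n" "0 \<le> v i"
    using mkt ij by (auto simp: market_def)
  let ?O = "{l. (l, j) \<in> E \<and> l \<noteq> i}"
  have O: "?O \<subseteq> {..<n}"
    using mkt by (auto simp: market_def)
  \<comment> \<open>The best rival for \<open>j\<close> as a set: empty if nobody else is interested
    in \<open>j\<close>, otherwise a singleton.\<close>
  obtain R where R: "R \<subseteq> ?O" "card R \<le> 1" "\<And>l. l \<in> ?O \<Longrightarrow> \<exists>r\<in>R. v l \<le> v r"
  proof (cases "?O = {}")
    case True
    then show ?thesis using that[of "{}"] by auto
  next
    case False
    have fin: "finite ?O"
      by (rule finite_subset[OF O]) simp
    then have "Max (v ` ?O) \<in> v ` ?O"
      using False by (intro Max_in) auto
    then obtain r where r: "r \<in> ?O" "Max (v ` ?O) = v r"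
      by blast
    then have "v l \<le> v r" if "l \<in> ?O" for l
      using Max_ge[OF finite_imageI[OF fin] imageI[OF that], of v] by simp
    then show ?thesis
      using r(1) by (intro that[of "{r}"]) auto
  qed
  have Rfin: "finite R" "i \<notin> R"
    using R(1) finite_subset[OF subset_trans[OF R(1) O]] by auto
  let ?T = "{t. \<forall>l\<in>insert i R. t l = (if l = i then Exploit else Explore)}"
  let ?S = "{0} \<times> ?T"
  \<comment> \<open>At most two types are prescribed, those of \<open>i\<close> and of the rival;
    this gives the factor 4.\<close>
  have "(1 / 2 :: real) ^ 2 \<le> (1 / 2) ^ card (insert i R)"
    by (rule power_decreasing) (use R(2) Rfin in auto)
  then have "1 / 4 \<le> measure_pmf.prob (type_pmf n) ?T"
    by (subst prob_types) (use R(1) O lt in \<open>auto simp: power2_eq_square\<close>)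
  then have prob: "1 / (4 * (nat \<lceil>log 2 (real n)\<rceil> + 1)) \<le> measure_pmf.prob (ee_seed n) ?S"
    using prob_seed_ge[of ?T n ?S] by (auto simp: field_simps)
  have served: "v i \<le> ?W r" if rS: "r \<in> ?S" for r
  proof -
    obtain t where r: "r = (0, t)" and "t \<in> ?T"
      using rS by blast
    then have t: "t i = Exploit" "\<And>l. l \<in> R \<Longrightarrow> t l = Explore"
      using Rfin(2) by (auto split: if_splits)
    show ?thesis
      unfolding r using R t by (intro top_buyer_served[OF sel mkt ties ij _ top]) blast+
  qed
  have "v i * (1 / (4 * (nat \<lceil>log 2 (real n)\<rceil> + 1))) \<le> v i * measure_pmf.prob (ee_seed n) ?S"
    by (rule mult_left_mono[OF prob lt(2)])
  also have "\<dots> \<le> measure_pmf.expectation (ee_seed n) ?W"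
    using sum_prob_le_expectation_ee_seed[of "{()}" "\<lambda>_. v i" "\<lambda>_. ?S" ?W n]
      served social_welfare_nonneg[OF mkt] by (simp add: indicator_def)
  finally show ?thesis
    by (simp add: expected_welfare_def field_simps)
qed

text \<open>The factor 16 is 2 for a price down to \<open>v i / 2\<close>, times 4 for the types of
  \<open>i\<close> and her rival, times 2 for the double charging; \<open>K + 1\<close> pays for
  guessing the scale.\<close>

lemma contested_value_le_expected_welfare:
  assumes sel: "selection_rule sel" and mkt: "market n m E v" and \<mu>: "matching n E \<mu>"
    and c: "0 \<le> c" "\<And>l j. (l, j) \<in> E \<Longrightarrow> v l \<le> c"
    and G: "G \<subseteq> dom \<mu>" "\<And>i. i \<in> G \<Longrightarrow> 0 < v i \<and> c \<le> real n * v i"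
    and rival: "\<And>i. i \<in> G \<Longrightarrow> \<exists>l j. l \<noteq> i \<and> (l, j) \<in> E \<and> j \<le> the (\<mu> i) \<and> v i / 2 \<le> v l"
  shows "sum v G \<le> 16 * (nat \<lceil>log 2 (real n)\<rceil> + 1) *
    expected_welfare n (ee_seed n) (explore_exploit n sel) m E v"
proof -
  let ?W = "\<lambda>r. social_welfare n E v (assigned (explore_exploit n sel r (truthful_report E v) m))"
  define K where "K = nat \<lceil>log 2 (real n)\<rceil>"
  define p where "p k t i = top_explored n E v t (the (\<mu> i)) / 2 ^ k" for k t i
  \<comment> \<open>The event that \<open>i\<close> can buy and the price at her optimal item is
    within a factor 2 below her value.\<close>
  define S where "S i = {(k, t). t i = Exploit \<and> v i / 2 \<le> p k t i \<and> p k t i \<le> v i}" for i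
  have dom: "dom \<mu> \<subseteq> {..<n}"
    using \<mu> by (simp add: matching_def)
  then have fin: "finite (dom \<mu>)" "finite G"
    using finite_subset[OF dom] finite_subset[OF G(1)] by simp_all
  have prob: "1 / (4 * (K + 1)) \<le> measure_pmf.prob (ee_seed n) (S i)" if i: "i \<in> G" for i
  proof -
    obtain l j where l: "l \<noteq> i" "(l, j) \<in> E" "j \<le> the (\<mu> i)" "v i / 2 \<le> v l"
      using rival[OF i] by blast
    have lt: "i < n" "l < n"
      using i G(1) dom l(2) mkt by (auto simp: market_def)
    have "log 2 (real n) \<le> real K"
      unfolding K_def by linarith
    then have nK: "real n \<le> 2 ^ K"
      using lt(1) by (simp add: log_le_iff powr_realpow)
    let ?T = "{t. \<forall>a\<in>{i, l}. t a = (if a = i then Exploit else Explore)}"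
    have "measure_pmf.prob (type_pmf n) ?T = 1 / 4"
      by (subst prob_types) (use lt l(1) in \<open>auto simp: power2_eq_square\<close>)
    moreover have "\<exists>k\<le>nat \<lceil>log 2 (real n)\<rceil>. (k, t) \<in> S i" if t: "t \<in> ?T" for t
    proof -
      let ?x = "top_explored n E v t (the (\<mu> i))"
      have "v l \<le> ?x"
        using t l(1) by (intro top_explored_ge[OF lt(2) _ l(2,3)]) auto
      then have lower: "v i / 2 \<le> ?x"
        using l(4) by linarith
      \<comment> \<open>This is where low values must be excluded: \<open>K\<close> halvings cover
        only a factor \<open>n\<close> between \<open>c\<close> and \<open>v i\<close>.\<close>
      have upper: "?x \<le> 2 ^ K * v i"
      proof -
        have "?x \<le> c"
          by (rule top_explored_le[OF c])
        also have "\<dots> \<le> real n * v i"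
          using G(2)[OF i] by simp
        also have "\<dots> \<le> 2 ^ K * v i"
          using nK G(2)[OF i] by (intro mult_right_mono) auto
        finally show ?thesis .
      qed
      obtain k where "k \<le> K" "v i / 2 \<le> ?x / 2 ^ k" "?x / 2 ^ k \<le> v i"
        by (rule dyadic_scale_between[OF conjunct1[OF G(2)[OF i]] lower upper])
      then show ?thesis
        using t by (auto simp: S_def p_def K_def)
    qed
    ultimately show ?thesis
      using prob_seed_ge[of ?T n "S i"] by (simp add: K_def field_simps)
  qed
  have "(\<Sum>i\<in>G. v i / 2 * indicator (S i) r) \<le> 2 * ?W r" for r
  proof -
    obtain k t where r: "r = (k, t)" by fastforce
    have "(\<Sum>i\<in>G. v i / 2 * indicator (S i) r) \<le>
      (\<Sum>i\<in>G. if t i = Exploit \<and> p k t i \<le> v i then p k t i else 0)"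
      unfolding r
      by (rule sum_mono) (auto simp: S_def indicator_def p_def intro!: divide_nonneg_nonneg top_explored_nonneg)
    also have "\<dots> \<le> (\<Sum>i\<in>dom \<mu>. if t i = Exploit \<and> p k t i \<le> v i then p k t i else 0)"
      by (rule sum_mono2[OF fin(1) G(1)]) (simp add: p_def top_explored_nonneg)
    also have "\<dots> \<le> 2 * ?W r"
      unfolding r p_def by (rule posted_price_charging[OF sel mkt \<mu>])
    finally show ?thesis .
  qed
  then have "(\<Sum>i\<in>G. v i / 2 * measure_pmf.prob (ee_seed n) (S i))
      \<le> measure_pmf.expectation (ee_seed n) (\<lambda>r. 2 * ?W r)"
    by (rule sum_prob_le_expectation_ee_seed[OF fin(2)])
  also have "\<dots> = 2 * expected_welfare n (ee_seed n) (explore_exploit n sel) m E v"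
    by (simp add: expected_welfare_def)
  finally have le: "(\<Sum>i\<in>G. v i / 2 * measure_pmf.prob (ee_seed n) (S i))
      \<le> 2 * expected_welfare n (ee_seed n) (explore_exploit n sel) m E v" .
  have nonneg: "0 \<le> v i / 2" if "i \<in> G" for i
    using G(2)[OF that] by simp
  have "(\<Sum>i\<in>G. v i / 2 * (1 / (4 * (K + 1))))
      \<le> 2 * expected_welfare n (ee_seed n) (explore_exploit n sel) m E v"
    by (intro order_trans[OF sum_mono le] mult_left_mono prob nonneg)
  moreover have "(\<Sum>i\<in>G. v i / 2 * (1 / (4 * (K + 1)))) = sum v G / (8 * (K + 1))"
    by (simp add: sum_divide_distrib)
  ultimately have "sum v G / (8 * (K + 1)) \<le>
      2 * expected_welfare n (ee_seed n) (explore_exploit n sel) m E v"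
    by (simp only:)
  then have "sum v G \<le> 2 * expected_welfare n (ee_seed n) (explore_exploit n sel) m E v * (8 * (K + 1))"
    by (subst (asm) pos_divide_le_eq) simp_all
  then show ?thesis
    by (simp add: K_def algebra_simps)
qed

text \<open>The low group costs \<open>V\<close> and the leading group \<open>2 * V\<close>, with
  \<open>V\<close> at most \<open>4 * (K + 1) * W\<close>; together with 16 for the contested group
  this makes 16 + 3 * 4 = 28.\<close>

lemma opt_le_expected_welfare:
  assumes sel: "selection_rule sel" and mkt: "market n m E v"
    and ties: "gainers_first sel \<or> inj_on v {..<n}"
  shows "opt n E v \<le> 28 * (nat \<lceil>log 2 (real n)\<rceil> + 1) *
    expected_welfare n (ee_seed n) (explore_exploit n sel) m E v"
proof -
  define K where "K = nat \<lceil>log 2 (real n)\<rceil>"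
  define W where "W = expected_welfare n (ee_seed n) (explore_exploit n sel) m E v"
  obtain \<mu> where \<mu>: "matching n E \<mu>" and opt: "opt n E v = sum v (dom \<mu>)"
    using opt_attained[OF mkt] .
  have W0: "0 \<le> W"
    unfolding W_def by (rule expected_welfare_nonneg[OF mkt])
  have E: "finite E"
    using mkt finite_subset[of E "{..<n} \<times> {..<m}"] by (auto simp: market_def)
  show ?thesis
  proof (cases "E = {}")
    case True
    then have "dom \<mu> = {}"
      using \<mu> by (auto simp: matching_def)
    then show ?thesis
      using opt W0 by (simp add: W_def)
  next
    case False
    \<comment> \<open>The maximum runs over edges, since a buyer without an edge may have a huge
      value that nobody can collect.\<close>
    obtain e where e: "e \<in> E" "Max ((v \<circ> fst) ` E) = (v \<circ> fst) e"
      using obtains_MAX[OF E False] by metis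
    obtain i0 j0 where e0: "e = (i0, j0)" by fastforce
    define V where "V = v i0"
    have top: "v l \<le> V" if "(l, j) \<in> E" for l j
      using Max_ge[OF finite_imageI[OF E], of "v l" "v \<circ> fst"] e(2) that
      by (force simp: V_def e0)
    have "i0 < n" and V0: "0 \<le> V"
      using mkt e(1) by (auto simp: market_def V_def e0)
    have VW: "V \<le> 4 * (K + 1) * W"
      using top_value_le_expected_welfare[OF sel mkt ties, of i0 j0] e(1) top
      unfolding V_def K_def W_def e0 by blast
    have D: "dom \<mu> \<subseteq> {..<n}" "finite (dom \<mu>)"
      using \<mu> finite_subset[of "dom \<mu>" "{..<n}"] by (simp_all add: matching_def)
    have edge: "(i, the (\<mu> i)) \<in> E" if "i \<in> dom \<mu>" for i
      using \<mu> that by (auto simp: matching_def)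
    have v0: "0 \<le> v i" if "i \<in> dom \<mu>" for i
      using mkt D(1) that by (auto simp: market_def)
    define low where "low = {i \<in> dom \<mu>. real n * v i \<le> V}"
    define contested where "contested = {i \<in> dom \<mu> - low.
      \<exists>l j. l \<noteq> i \<and> (l, j) \<in> E \<and> j \<le> the (\<mu> i) \<and> v i / 2 \<le> v l}"
    define leading where "leading = dom \<mu> - low - contested"
    have "sum v low \<le> V"
    proof -
      have "sum v low \<le> real (card low) * (V / n)"
        by (rule sum_bounded_above) (use \<open>i0 < n\<close> in \<open>auto simp: low_def field_simps\<close>)
      also have "card low \<le> n"
        using card_mono[of "{..<n}" low] D(1) by (auto simp: low_def)
      then have "real (card low) * (V / n) \<le> real n * (V / n)"
        using V0 by (intro mult_right_mono) auto
      finally show ?thesis using \<open>i0 < n\<close> by simp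
    qed
    moreover have "sum v contested \<le> 16 * (K + 1) * W"
      unfolding K_def W_def
    proof (rule contested_value_le_expected_welfare[OF sel mkt \<mu> V0 top])
      show "0 < v i \<and> V \<le> real n * v i" if "i \<in> contested" for i
      proof -
        have "V < real n * v i" 
          using that by (auto simp: contested_def low_def)
        moreover from this have "0 < real n * v i"
          using V0 by linarith
        ultimately show ?thesis
          by (auto simp: zero_less_mult_iff)
      qed
    qed (auto simp: contested_def)
    moreover have "sum v leading \<le> 2 * V"
    proof (rule sum_le_of_doubling)
      \<comment> \<open>Otherwise \<open>a\<close>, interested in her own optimal item no later than
        that of \<open>b\<close>, would witness that \<open>b\<close> is contested.\<close>
      have *: "v a < v b / 2" if "a \<in> leading" "b \<in> leading" "a \<noteq> b" "the (\<mu> a) \<le> the (\<mu> b)" for a b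
      proof (rule ccontr)
        assume "\<not> v a < v b / 2"
        then have "\<exists>l j. l \<noteq> b \<and> (l, j) \<in> E \<and> j \<le> the (\<mu> b) \<and> v b / 2 \<le> v l"
          using that edge[of a] by (intro exI[of _ a] exI[of _ "the (\<mu> a)"]) (auto simp: leading_def)
        with that(2) show False
          by (auto simp: leading_def contested_def)
      qed
      show "v a < v b / 2 \<or> v b < v a / 2" if "a \<in> leading" "b \<in> leading" "a \<noteq> b" for a b
        using *[of a b] *[of b a] that by linarith
      show "v a \<le> V" if "a \<in> leading" for a
        using top[OF edge] that by (simp add: leading_def)
    qed (use D V0 v0 in \<open>auto simp: leading_def\<close>)
    moreover have "sum v (dom \<mu>) = sum v low + sum v contested + sum v leading"
    proof -
      have "sum v (dom \<mu>) = sum v low + sum v (dom \<mu> - low)"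
        by (subst sum.subset_diff[of low "dom \<mu>"]) (auto simp: low_def D)
      also have "sum v (dom \<mu> - low) = sum v contested + sum v leading"
        unfolding leading_def
        by (subst sum.subset_diff[of contested "dom \<mu> - low"]) (auto simp: contested_def D)
      finally show ?thesis by simp
    qed
    ultimately have "opt n E v \<le> 16 * (K + 1) * W + 3 * V"
      using opt by linarith
    also have "\<dots> \<le> 16 * (K + 1) * W + 3 * (4 * (K + 1) * W)"
      using VW by linarith
    finally show ?thesis
      by (simp add: K_def W_def algebra_simps)
  qed
qed

text \<open>From \<open>n = 2\<close> on, the logarithm \<open>l\<close> to base 2 is at least 1, so
  28 * (l + 2) is at most 84 * l.\<close>

lemma ceiling_log_bigo_ln: "(\<lambda>n. 28 * (real (nat \<lceil>log 2 (real n)\<rceil>) + 1)) \<in> O(\<lambda>n. ln (real n))"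
proof (rule bigoI)
  show "\<forall>\<^sub>F n in sequentially. norm (28 * (real (nat \<lceil>log 2 (real n)\<rceil>) + 1))
    \<le> 84 / ln 2 * norm (ln (real n))"
    using eventually_ge_at_top[of 2]
  proof eventually_elim
    case (elim n)
    have "1 \<le> log 2 (real n)"
      using elim by (simp add: le_log_iff)
    moreover have "28 * (x + 1) \<le> 84 * l" if "1 \<le> l" "x \<le> l + 1" for x :: real and l :: real
      using that by (simp add: algebra_simps)
    moreover have "real (nat \<lceil>log 2 (real n)\<rceil>) \<le> log 2 (real n) + 1"
      using of_int_ceiling_le_add_one[of "log 2 (real n)"] \<open>1 \<le> log 2 (real n)\<close> by simp
    ultimately have "28 * (real (nat \<lceil>log 2 (real n)\<rceil>) + 1) \<le> 84 * log 2 (real n)"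
      by blast
    also have "\<dots> = 84 / ln 2 * ln (real n)"
      by (simp add: log_def)
    finally have "28 * (real (nat \<lceil>log 2 (real n)\<rceil>) + 1) \<le> 84 / ln 2 * ln (real n)" .
    moreover have "norm (28 * (real (nat \<lceil>log 2 (real n)\<rceil>) + 1)) = 28 * (real (nat \<lceil>log 2 (real n)\<rceil>) + 1)"
      unfolding real_norm_def by (rule abs_of_nonneg) simp
    moreover have "norm (ln (real n)) = ln (real n)"
      using elim by simp
    ultimately show ?case by (simp only:)
  qed
qed

theorem theorem7:
  "(\<forall>n\<ge>1. \<forall>sel. selection_rule sel \<and> consistent sel \<longrightarrow>
      truthful n (ee_seed n) (explore_exploit n sel) \<and>
      individually_rational n (ee_seed n) (explore_exploit n sel)) \<and>
   (\<exists>\<alpha> :: nat \<Rightarrow> real. \<alpha> \<in> O(\<lambda>n. ln (real n)) \<and>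
      (\<forall>n\<ge>1. \<forall>sel m E v.
         selection_rule sel \<and> market n m E v \<and> (gainers_first sel \<or> inj_on v {..<n}) \<longrightarrow>
         opt n E v \<le> \<alpha> n * expected_welfare n (ee_seed n) (explore_exploit n sel) m E v))"
proof (intro conjI exI[of _ "\<lambda>n. 28 * (real (nat \<lceil>log 2 (real n)\<rceil>) + 1)"] allI impI ceiling_log_bigo_ln)
  fix n sel m E v
  assume "selection_rule sel \<and> market n m E v \<and> (gainers_first sel \<or> inj_on v {..<n})"
  then show "opt n E v \<le> 28 * (real (nat \<lceil>log 2 (real n)\<rceil>) + 1) *
      expected_welfare n (ee_seed n) (explore_exploit n sel) m E v"
    using opt_le_expected_welfare[of sel n m E v] by (simp add: add.commute)
qed (simp_all add: explore_exploit_truthful explore_exploit_individually_rational)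

end
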